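(* If a permutation class $C$ is LR-amalgamable, then its LR-closure $C^{\mathrm{LR}}$ is LR-amalgamable and thus also 1-amalgamable.
   Context: A permutation of length $n\ge 1$ is a sequence of all the $n$ distinct numbers of $[n]=\{1,\dots,n\}$. An embedding of a permutation $\sigma$ of length $k$ into a permutation $\pi$ of length $n$ is a strictly increasing function $f:[k]\to[n]$ such that $\pi_{f(1)},\dots,\pi_{f(k)}$ is order-isomorphic to $\sigma$ (has the same relative order). $\pi$ contains $\sigma$ if such an embedding exists. A permutation class is a set of permutations closed under taking contained permutations. For a permutation $\pi$ of length $n$ and non-empty permutations $\sigma_1,\dots,\sigma_n$, the inflation $\pi[\sigma_1,\dots,\sigma_n]$ is the permutation that is a concatenation of blocks $\overline\sigma_1\cdots\overline\sigma_n$, where $\overline\sigma_i$ is order-isomorphic to $\sigma_i$, and whenever $\pi_i<\pi_j$ all elements of $\overline\sigma_i$ are smaller than all elements of $\overline\sigma_j$. An element $\pi_i$ is a left-to-right minimum (LR-minimum) of $\pi$ if it is smaller than all elements preceding it. If $\pi$ has $k$ LR-minima and $\sigma_1,\dots,\sigma_k$ are non-empty permutations, the LR-inflation $\pi\langle\sigma_1,\dots,\sigma_k\rangle$ is the permutation obtained by inflating the LR-minima of $\pi$ (taken from left to right) by $\sigma_1,\dots,\sigma_k$ and leaving every other element uninflated (i.e. inflated by the singleton permutation). A permutation class $C$ is closed under LR-inflations if for every $\pi\in C$ with $k$ LR-minima and all $\sigma_1,\dots,\sigma_k\in C$, we have $\pi\langle\sigma_1,\dots,\sigma_k\rangle\in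 C$. The LR-closure of $C$, denoted $C^{\mathrm{LR}}$, is the smallest permutation class that contains $C$ and is closed under LR-inflations. A permutation class $C$ is 1-amalgamable if for any $\tau_1,\tau_2\in C$ and any mappings $f_1,f_2$, where $f_i$ is an embedding of the singleton permutation $1$ into $\tau_i$, there is $\sigma\in C$ and mappings $g_1,g_2$ such that $g_i$ is an embedding of $\tau_i$ into $\sigma$ and $g_1\circ f_1=g_2\circ f_2$. A permutation class $C$ is LR-amalgamable if for any $\tau_1,\tau_2\in C$ and any mappings $f_1,f_2$, where $f_i$ is an embedding of the singleton permutation into $\tau_i$ whose image is not an LR-minimum of $\tau_i$, there is $\sigma\in C$ and mappings $g_1,g_2$ such that $g_i$ is an embedding of $\tau_i$ into $\sigma$, $g_1\circ f_1=g_2\circ f_2$, and moreover each $g_i$ preserves the property of being an LR-minimum (it maps LR-minima of $\tau_i$ to LR-minima of $\sigma$). *)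

theory Defs
  imports Main
begin

text \<open>
  Permutations are lists of values in one-line notation. Values run over 1..n, as usual, but
  positions are list indices and hence run over 0..n-1.
\<close>

definition is_perm :: "nat list \<Rightarrow> bool" where
  "is_perm p \<longleftrightarrow> p \<noteq> [] \<and> distinct p \<and> set p = {1..length p}"

text \<open>An embedding of s into p is a function on positions; only its values on the positions
  of s matter.\<close>

definition embedding :: "(nat \<Rightarrow> nat) \<Rightarrow> nat list \<Rightarrow> nat list \<Rightarrow> bool" where
  "embedding f s p \<longleftrightarrow>
     f ` {..<length s} \<subseteq> {..<length p} \<and>
     strict_mono_on {..<length s} f \<and>
     (\<forall>i<length s. \<forall>j<length s. p ! f i < p ! f j \<longleftrightarrow> s ! i < s ! j)"

definition contains :: "nat list \<Rightarrow> nat list \<Rightarrow> bool" where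
  "contains p s \<longleftrightarrow> (\<exists>f. embedding f s p)"

definition perm_class :: "nat list set \<Rightarrow> bool" where
  "perm_class C \<longleftrightarrow>
     (\<forall>p\<in>C. is_perm p) \<and> (\<forall>p\<in>C. \<forall>s. is_perm s \<and> contains p s \<longrightarrow> s \<in> C)"

text \<open>The block replacing the i-th entry of p is the i-th list of ss, shifted up by the total
  size of the blocks lying below it.\<close>

definition inflate :: "nat list \<Rightarrow> nat list list \<Rightarrow> nat list" where
  "inflate p ss =
     concat (map (\<lambda>i. map (\<lambda>v. v + (\<Sum>j | j < length p \<and> p ! j < p ! i. length (ss ! j))) (ss ! i))
       [0..<length p])"

definition lr_min :: "nat list \<Rightarrow> nat \<Rightarrow> bool" where
  "lr_min p i \<longleftrightarrow> i < length p \<and> (\<forall>j<i. p ! i < p ! j)"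

text \<open>An LR-minimum preceded by exactly m other LR-minima is inflated by the list of index m
  in ss.\<close>

definition lr_inflate :: "nat list \<Rightarrow> nat list list \<Rightarrow> nat list" where
  "lr_inflate p ss =
     inflate p (map (\<lambda>i. if lr_min p i then ss ! card {j. j < i \<and> lr_min p j} else [1])
       [0..<length p])"

definition closed_under_lr_inflations :: "nat list set \<Rightarrow> bool" where
  "closed_under_lr_inflations C \<longleftrightarrow>
     (\<forall>p\<in>C. \<forall>ss. length ss = card {i. lr_min p i} \<and> set ss \<subseteq> C \<longrightarrow> lr_inflate p ss \<in> C)"

text \<open>That this intersection is itself such a class is \<open>lr_closure_least\<close> below.\<close>

definition lr_closure :: "nat list set \<Rightarrow> nat list set" where
  "lr_closure C = \<Inter> {D. perm_class D \<and> C \<subseteq> D \<and> closed_under_lr_inflations D}"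

text \<open>The singleton permutation has the single position 0, so equality of the composed
  embeddings amounts to equality at 0, and the image of an embedding f of it is f 0.\<close>

definition one_amalgamable :: "nat list set \<Rightarrow> bool" where
  "one_amalgamable C \<longleftrightarrow>
     (\<forall>t1\<in>C. \<forall>t2\<in>C. \<forall>f1 f2.
        embedding f1 [1] t1 \<and> embedding f2 [1] t2 \<longrightarrow>
        (\<exists>s\<in>C. \<exists>g1 g2. embedding g1 t1 s \<and> embedding g2 t2 s \<and>
           (g1 \<circ> f1) 0 = (g2 \<circ> f2) 0))"

definition lr_amalgamable :: "nat list set \<Rightarrow> bool" where
  "lr_amalgamable C \<longleftrightarrow>
     (\<forall>t1\<in>C. \<forall>t2\<in>C. \<forall>f1 f2.
        embedding f1 [1] t1 \<and> \<not> lr_min t1 (f1 0) \<and>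
        embedding f2 [1] t2 \<and> \<not> lr_min t2 (f2 0) \<longrightarrow>
        (\<exists>s\<in>C. \<exists>g1 g2. embedding g1 t1 s \<and> embedding g2 t2 s \<and>
           (g1 \<circ> f1) 0 = (g2 \<circ> f2) 0 \<and>
           (\<forall>i. lr_min t1 i \<longrightarrow> lr_min s (g1 i)) \<and>
           (\<forall>i. lr_min t2 i \<longrightarrow> lr_min s (g2 i))))"

lemma is_perm_inflate:
  assumes p: "is_perm p" and len: "length ss = length p" and ss: "\<And>s. s \<in> set ss \<Longrightarrow> is_perm s"
  shows "is_perm (inflate p ss)"
proof -
  let ?n = "length p"
  define l where "l i = length (ss ! i)" for i
  define off where "off i = (\<Sum>j | j < ?n \<and> p ! j < p ! i. l j)" for i
  define B where "B i = {off i + 1 .. off i + l i}" for i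
  define N where "N = (\<Sum>i<?n. l i)"
  have perm: "is_perm (ss ! i)" if "i < ?n" for i using that len ss by simp
  have infl: "inflate p ss = concat (map (\<lambda>i. map (\<lambda>v. v + off i) (ss ! i)) [0..<?n])"
    by (simp add: inflate_def off_def l_def)
  have img: "(\<lambda>v. v + off i) ` set (ss ! i) = B i" if "i < ?n" for i
  proof -
    have "set (ss ! i) = {1..l i}" using perm[OF that] by (simp add: is_perm_def l_def)
    then show ?thesis by (simp add: B_def add.commute)
  qed
  have set: "set (inflate p ss) = (\<Union>i<?n. B i)"
    unfolding infl using img by (auto simp: lessThan_atLeast0)
  have length: "length (inflate p ss) = N"
    unfolding infl by (simp add: length_concat o_def N_def l_def sum_list_distinct_conv_sum_set
        lessThan_atLeast0)
  have below: "off i + l i = (\<Sum>j\<in>insert i {j. j < ?n \<and> p ! j < p ! i}. l j)" for i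
    by (simp add: off_def)
  have top: "off i + l i \<le> N" if "i < ?n" for i
    unfolding below N_def by (rule sum_mono2) (use that in auto)
  have less: "off i + l i \<le> off j" if "i < ?n" "p ! i < p ! j" for i j
    unfolding below unfolding off_def[of j] by (rule sum_mono2) (use that in auto)
  have disj: "B i \<inter> B j = {}" if "i < ?n" "j < ?n" "i \<noteq> j" for i j
  proof -
    have "p ! i \<noteq> p ! j" using p that by (simp add: is_perm_def nth_eq_iff_index_eq)
    then have "off i + l i \<le> off j \<or> off j + l j \<le> off i" using less that by (meson linorder_neqE_nat)
    then show ?thesis by (auto simp: B_def)
  qed
  have card: "card (\<Union>i<?n. B i) = N"
    unfolding N_def by (subst card_UN_disjoint) (use disj in \<open>auto simp: B_def\<close>)
  have "(\<Union>i<?n. B i) \<subseteq> {1..N}" using top by (fastforce simp: B_def)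
  then have eq: "(\<Union>i<?n. B i) = {1..N}" using card by (intro card_subset_eq) auto
  have n: "0 < ?n" using p by (simp add: is_perm_def)
  then have "l 0 > 0" using perm[of 0] by (simp add: is_perm_def l_def)
  then have "N > 0" using top[OF n] by simp
  then have "inflate p ss \<noteq> []" using length by auto
  moreover have "distinct (inflate p ss)" using card set length by (simp add: card_distinct)
  ultimately show ?thesis using set eq length by (simp add: is_perm_def)
qed

lemma is_perm_lr_inflate:
  assumes p: "is_perm p" and len: "length ss = card {i. lr_min p i}"
    and ss: "\<And>s. s \<in> set ss \<Longrightarrow> is_perm s"
  shows "is_perm (lr_inflate p ss)"
  unfolding lr_inflate_def
proof (rule is_perm_inflate[OF p])
  have fin: "finite {i. lr_min p i}" by (rule finite_subset[of _ "{..<length p}"]) (auto simp: lr_min_def)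
  have "ss ! card {j. j < i \<and> lr_min p j} \<in> set ss" if "lr_min p i" for i
  proof -
    have "card {j. j < i \<and> lr_min p j} < card {i. lr_min p i}"
      by (rule psubset_card_mono[OF fin]) (use that in auto)
    then show ?thesis using len by simp
  qed
  then show "is_perm s"
    if "s \<in> set (map (\<lambda>i. if lr_min p i then ss ! card {j. j < i \<and> lr_min p j} else [1])
          [0..<length p])" for s
    using that ss by (auto simp: is_perm_def split: if_splits)
qed simp

lemma lr_closure_least:
  assumes C: "perm_class C"
  shows "perm_class (lr_closure C)" "C \<subseteq> lr_closure C" "closed_under_lr_inflations (lr_closure C)"
    and "perm_class D \<Longrightarrow> C \<subseteq> D \<Longrightarrow> closed_under_lr_inflations D \<Longrightarrow> lr_closure C \<subseteq> D"
proof -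
  define S where "S = {D. perm_class D \<and> C \<subseteq> D \<and> closed_under_lr_inflations D}"
  have cl: "lr_closure C = \<Inter> S" by (simp add: lr_closure_def S_def)
  have "closed_under_lr_inflations (Collect is_perm)"
    unfolding closed_under_lr_inflations_def
    using is_perm_lr_inflate by (metis mem_Collect_eq subsetD)
  moreover have "perm_class (Collect is_perm)" by (simp add: perm_class_def)
  moreover have "C \<subseteq> Collect is_perm" using C by (auto simp: perm_class_def)
  ultimately have all: "Collect is_perm \<in> S" by (simp add: S_def)
  show "perm_class (lr_closure C)"
    unfolding perm_class_def
  proof (intro conjI ballI allI impI)
    show "is_perm p" if "p \<in> lr_closure C" for p using that all cl by blast
    show "s \<in> lr_closure C" if "p \<in> lr_closure C" "is_perm s \<and> contains p s" for p s
      unfolding cl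
    proof
      fix D assume "D \<in> S"
      then have "perm_class D" "p \<in> D" using that(1) cl by (auto simp: S_def)
      then show "s \<in> D" using that(2) by (meson perm_class_def)
    qed
  qed
  show "C \<subseteq> lr_closure C" by (auto simp: cl S_def)
  show "closed_under_lr_inflations (lr_closure C)"
    unfolding closed_under_lr_inflations_def
  proof (intro ballI allI impI)
    fix p ss assume p: "p \<in> lr_closure C"
      and ss: "length ss = card {i. lr_min p i} \<and> set ss \<subseteq> lr_closure C"
    show "lr_inflate p ss \<in> lr_closure C"
      unfolding cl
    proof
      fix D assume D: "D \<in> S"
      then have "closed_under_lr_inflations D" "p \<in> D" "set ss \<subseteq> D"
        using p ss cl by (auto simp: S_def)
      then show "lr_inflate p ss \<in> D"
        using ss by (meson closed_under_lr_inflations_def)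
    qed
  qed
  show "perm_class D \<Longrightarrow> C \<subseteq> D \<Longrightarrow> closed_under_lr_inflations D \<Longrightarrow> lr_closure C \<subseteq> D"
    by (auto simp: cl S_def)
qed

end

theory Submission
  imports Defs
begin

text \<open>
  Positions of an inflation are pairs of a block and a position in it.  The pairs are ordered
  lexicographically, and the entry at a pair is an LR-minimum iff the block sits on an LR-minimum
  of the skeleton and the position is an LR-minimum of the block.  Hence embeddings that preserve
  LR-minima can be built blockwise (\<open>ex_lr_embedding_inflation\<close>).

  The smallest set \<open>lr_generated C\<close> containing a class \<open>C\<close> and closed under LR-inflations is
  automatically closed under subpermutations, so it is the LR-closure
  (\<open>lr_closure_eq_lr_generated\<close>), and properties of the LR-closure can be proved by induction along
  LR-inflations.

  Suppose that \<open>p\<close> and all the permutations \<open>S i\<close> amalgamate with \<open>t\<close>.  Then so does the LR-inflation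
  of \<open>p\<close> by \<open>S\<close> (\<open>amalgamable_in_lr_inflation\<close>).  The chosen entry, not being an LR-minimum, has one
  of two places.  If it lies in a block \<open>S i\<close>, it is not an LR-minimum of that block.  Amalgamate
  the block with \<open>t\<close> and inflate \<open>p\<close> by the result in place of \<open>S i\<close>.  The LR-minima of \<open>t\<close> survive
  because the block sits on an LR-minimum.  Otherwise it is an entry of \<open>p\<close> that is not inflated.
  Amalgamate \<open>p\<close> with \<open>t\<close> and inflate the images of the LR-minima of \<open>p\<close>, which are again LR-minima,
  by the old blocks.  An LR-minimum of \<open>t\<close> goes to the first entry of its block.  Induction on both
  arguments reduces LR-amalgamability of the LR-closure to that of \<open>C\<close>.

  For 1-amalgamability only the case of a chosen LR-minimum is left, and inflating this
  LR-minimum by the whole second permutation is an amalgam there.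
\<close>

section \<open>Permutations and embeddings\<close>

lemma perm_nth_eq_iff:
  assumes "is_perm p" "i < length p" "j < length p"
  shows "p ! i = p ! j \<longleftrightarrow> i = j"
  using assms by (simp add: is_perm_def nth_eq_iff_index_eq)

lemma perm_nth_bounds:
  assumes "is_perm p" "i < length p"
  shows "1 \<le> p ! i" "p ! i \<le> length p"
  using assms nth_mem[of i p] by (auto simp: is_perm_def)

lemma is_perm_singleton: "is_perm [1]"
  by (simp add: is_perm_def)

lemma perm_length_pos: "is_perm p \<Longrightarrow> 0 < length p"
  by (simp add: is_perm_def)

lemma perm_of_length_one: "is_perm p \<Longrightarrow> length p \<le> 1 \<Longrightarrow> p = [1]"
  by (cases p) (auto simp: is_perm_def)

text \<open>An entry of a permutation is its own rank, so the relative order determines it.\<close>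

lemma perm_nth_eq_rank:
  assumes p: "is_perm p" and i: "i < length p"
  shows "p ! i = card {j. j < length p \<and> p ! j \<le> p ! i}"
proof -
  have inj: "inj_on ((!) p) {j. j < length p \<and> p ! j \<le> p ! i}"
    using p by (auto simp: inj_on_def perm_nth_eq_iff)
  have "(!) p ` {j. j < length p \<and> p ! j \<le> p ! i} = {1..p ! i}"
  proof
    show "(!) p ` {j. j < length p \<and> p ! j \<le> p ! i} \<subseteq> {1..p ! i}"
      using perm_nth_bounds(1)[OF p] by auto
    show "{1..p ! i} \<subseteq> (!) p ` {j. j < length p \<and> p ! j \<le> p ! i}"
    proof
      fix v assume v: "v \<in> {1..p ! i}"
      then have "v \<in> set p" using perm_nth_bounds[OF p i] p by (auto simp: is_perm_def)
      then obtain j where "j < length p" "p ! j = v" by (auto simp: in_set_conv_nth)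
      then show "v \<in> (!) p ` {j. j < length p \<and> p ! j \<le> p ! i}" using v by auto
    qed
  qed
  then show ?thesis using card_image[OF inj] by simp
qed

lemma perm_eqI:
  assumes p: "is_perm p" and q: "is_perm q" and len: "length p = length q"
    and ord: "\<And>i j. i < length p \<Longrightarrow> j < length p \<Longrightarrow> p ! i < p ! j \<longleftrightarrow> q ! i < q ! j"
  shows "p = q"
proof (rule nth_equalityI[OF len])
  fix i assume i: "i < length p"
  have "{j. j < length p \<and> p ! j \<le> p ! i} = {j. j < length q \<and> q ! j \<le> q ! i}"
    using ord[OF i] len by (auto simp: not_less[symmetric])
  then show "p ! i = q ! i" using perm_nth_eq_rank[OF p i] perm_nth_eq_rank[OF q] i len by simp
qed

lemma embedding_bound: "embedding f s p \<Longrightarrow> i < length s \<Longrightarrow> f i < length p"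
  by (auto simp: embedding_def)

lemma embedding_less_iff:
  assumes "embedding f s p" "i < length s" "j < length s"
  shows "f i < f j \<longleftrightarrow> i < j"
proof -
  have "\<And>x y. x < length s \<Longrightarrow> y < length s \<Longrightarrow> x < y \<Longrightarrow> f x < f y"
    using assms(1) by (auto simp: embedding_def strict_mono_on_def)
  then show ?thesis using assms(2,3) by (metis less_asym linorder_neqE_nat)
qed

lemma embedding_eq_iff:
  assumes "embedding f s p" "i < length s" "j < length s"
  shows "f i = f j \<longleftrightarrow> i = j"
  using embedding_less_iff[OF assms] embedding_less_iff[OF assms(1,3,2)]
  by (metis less_irrefl linorder_neqE_nat)

lemma embedding_nth_less_iff:
  "embedding f s p \<Longrightarrow> i < length s \<Longrightarrow> j < length s \<Longrightarrow> p ! f i < p ! f j \<longleftrightarrow> s ! i < s ! j"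
  by (auto simp: embedding_def)

lemma embeddingI:
  assumes "\<And>i. i < length s \<Longrightarrow> f i < length p"
    and "\<And>i j. i < j \<Longrightarrow> j < length s \<Longrightarrow> f i < f j"
    and "\<And>i j. i < length s \<Longrightarrow> j < length s \<Longrightarrow> p ! f i < p ! f j \<longleftrightarrow> s ! i < s ! j"
  shows "embedding f s p"
  using assms by (auto simp: embedding_def strict_mono_on_def)

lemma embedding_id: "embedding (\<lambda>i. i) p p"
  by (auto intro!: embeddingI)

lemma embedding_singleton_iff: "embedding f [v] p \<longleftrightarrow> f 0 < length p"
  by (auto simp: embedding_def strict_mono_on_def)

text \<open>A strictly increasing function on an initial segment enumerates its image, so two
  embeddings with the same image are the same function, and they induce the same relative order.\<close>

lemma perm_eq_if_same_image:
  assumes s: "is_perm s" "embedding f s p" and t: "is_perm t" "embedding g t p"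
    and img: "f ` {..<length s} = g ` {..<length t}"
  shows "s = t"
proof -
  have srt: "sorted (map f [0..<length s]) \<and> distinct (map f [0..<length s])"
    if "embedding f s p" for f and s :: "nat list"
  proof -
    have mono: "f i < f j" if "i < j" "j < length s" for i j
      using embedding_less_iff[OF \<open>embedding f s p\<close>] that by simp
    have "sorted_wrt (<) (map f [0..<length s])"
      using mono by (auto simp: sorted_wrt_iff_nth_less)
    then show ?thesis by (simp add: strict_sorted_iff)
  qed
  have eq: "map f [0..<length s] = map g [0..<length t]"
    by (rule sorted_distinct_set_unique)
      (use srt[OF s(2)] srt[OF t(2)] img in \<open>auto simp: lessThan_atLeast0\<close>)
  then have len: "length s = length t" using map_eq_imp_length_eq by fastforce
  have fg: "f i = g i" if "i < length s" for i
    using arg_cong[OF eq, of "\<lambda>xs. xs ! i"] that len by simp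
  show ?thesis
  proof (rule perm_eqI[OF s(1) t(1) len])
    fix i j assume "i < length s" "j < length s"
    then show "s ! i < s ! j \<longleftrightarrow> t ! i < t ! j"
      using embedding_nth_less_iff[OF s(2)] embedding_nth_less_iff[OF t(2)] fg len by metis
  qed
qed

text \<open>The witness is the enumeration of \<open>A\<close> together with the ranks of the entries within \<open>A\<close>.\<close>

lemma ex_restriction:
  assumes p: "is_perm p" and A: "A \<subseteq> {..<length p}" "A \<noteq> {}"
  obtains s f where "is_perm s" "embedding f s p" "f ` {..<length s} = A"
proof -
  have fin: "finite A" using A finite_subset by blast
  define xs where "xs = sorted_list_of_set A"
  have xs: "set xs = A" "distinct xs" "sorted_wrt (<) xs"
    using fin by (auto simp: xs_def strict_sorted_iff)
  have mem: "xs ! i \<in> A" if "i < length xs" for i using xs(1) that nth_mem by blast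
  define r where "r i = card {j \<in> A. p ! j \<le> p ! i}" for i
  define s where "s = map r xs"
  have le: "r i \<le> r j" if "p ! i \<le> p ! j" for i j
    unfolding r_def by (rule card_mono) (use fin that in auto)
  have less: "r i < r j" if "j \<in> A" "p ! i < p ! j" for i j
    unfolding r_def
    by (rule psubset_card_mono) (use fin that in \<open>auto simp: psubset_eq set_eq_iff intro: exI[of _ j]\<close>)
  have r: "r i < r j \<longleftrightarrow> p ! i < p ! j" if "i \<in> A" "j \<in> A" for i j
    using le[of j i] less[of j i] that by (meson not_less)
  have inj: "inj_on r A"
  proof (rule inj_onI)
    fix i j assume ij: "i \<in> A" "j \<in> A" "r i = r j"
    then have "p ! i = p ! j" using r[of i j] r[of j i] by (metis less_irrefl linorder_neqE_nat)
    then show "i = j" using p A ij perm_nth_eq_iff by (metis lessThan_iff subsetD)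
  qed
  have "r ` A = {1..card A}"
  proof (rule card_subset_eq)
    show "r ` A \<subseteq> {1..card A}"
    proof (clarsimp simp: Suc_le_eq)
      fix i assume i: "i \<in> A"
      have "{j \<in> A. p ! j \<le> p ! i} \<noteq> {}" using i by auto
      then show "0 < r i \<and> r i \<le> card A"
        using fin by (auto simp: r_def card_gt_0_iff intro: card_mono)
    qed
    show "card (r ` A) = card {1..card A}" using inj by (simp add: card_image)
  qed simp
  moreover have "length xs = card A" using xs by (metis distinct_card)
  ultimately have "is_perm s"
    using A(2) xs inj by (auto simp: is_perm_def s_def distinct_map)
  moreover have "embedding ((!) xs) s p"
  proof (rule embeddingI)
    fix i assume "i < length s" then show "xs ! i < length p" using mem A by (auto simp: s_def)
  next
    fix i j assume "i < j" "j < length s"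
    then show "xs ! i < xs ! j" using xs(3) by (simp add: s_def sorted_wrt_iff_nth_less)
  next
    fix i j assume "i < length s" "j < length s"
    then show "p ! (xs ! i) < p ! (xs ! j) \<longleftrightarrow> s ! i < s ! j" using r mem by (simp add: s_def)
  qed
  moreover have "(!) xs ` {..<length s} = A"
    using xs(1) by (auto simp: s_def set_conv_nth)
  ultimately show thesis using that by blast
qed

lemma lr_min_0: "is_perm p \<Longrightarrow> lr_min p 0"
  by (simp add: lr_min_def is_perm_def)

lemma lr_min_if_embedding:
  assumes "embedding f s p" "i < length s" "lr_min p (f i)"
  shows "lr_min s i"
  using assms embedding_less_iff[OF assms(1)] embedding_nth_less_iff[OF assms(1)]
  unfolding lr_min_def by (metis dual_order.strict_trans)


section \<open>Inflations indexed by positions\<close>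

text \<open>Blocks are given by a function on positions, so that a family of blocks can be changed
  or transported along an embedding.\<close>

definition inflation :: "nat list \<Rightarrow> (nat \<Rightarrow> nat list) \<Rightarrow> nat list" where
  "inflation p B = inflate p (map B [0..<length p])"

definition block_pos :: "(nat \<Rightarrow> nat list) \<Rightarrow> nat \<Rightarrow> nat \<Rightarrow> nat" where
  "block_pos B i k = (\<Sum>j<i. length (B j)) + k"

lemma inflation_cong:
  "(\<And>i. i < length p \<Longrightarrow> B i = B' i) \<Longrightarrow> inflation p B = inflation p B'"
  unfolding inflation_def by (rule arg_cong[where f = "inflate p"]) simp

lemma is_perm_inflation:
  assumes "is_perm p" "\<And>i. i < length p \<Longrightarrow> is_perm (B i)"
  shows "is_perm (inflation p B)"
  unfolding inflation_def by (rule is_perm_inflate) (use assms in auto)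

text \<open>Position \<open>k'\<close> may lie outside its block, so that the end of the whole inflation is
  included as position \<open>0\<close> of a block after the last.\<close>

lemma block_pos_mono:
  assumes "i < i'" "k < length (B i)"
  shows "block_pos B i k < block_pos B i' k'"
proof -
  have "(\<Sum>j<Suc i. length (B j)) \<le> (\<Sum>j<i'. length (B j))"
    by (rule sum_mono2) (use assms in auto)
  then show ?thesis using assms by (simp add: block_pos_def)
qed

lemma block_pos_less_iff:
  assumes "k < length (B i)" "k' < length (B i')"
  shows "block_pos B i k < block_pos B i' k' \<longleftrightarrow> i < i' \<or> i = i' \<and> k < k'"
  using block_pos_mono[of i i' k B k'] block_pos_mono[of i' i k' B k] assms
  by (cases i i' rule: linorder_cases) (auto simp: block_pos_def)

lemma block_pos_eq_iff:
  assumes "k < length (B i)" "k' < length (B i')"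
  shows "block_pos B i k = block_pos B i' k' \<longleftrightarrow> i = i' \<and> k = k'"
  using block_pos_mono[of i i' k B k'] block_pos_mono[of i' i k' B k] assms
  by (cases i i' rule: linorder_cases) (auto simp: block_pos_def)

lemma length_concat_upt: "length (concat (map g [0..<n])) = (\<Sum>j<n. length (g j))"
  by (induction n) simp_all

lemma nth_concat_upt:
  assumes "i < n" "k < length (g i)"
  shows "concat (map g [0..<n]) ! ((\<Sum>j<i. length (g j)) + k) = g i ! k"
  using assms
proof (induction n)
  case (Suc n)
  show ?case
  proof (cases "i = n")
    case True
    then show ?thesis using Suc.prems by (simp add: nth_append length_concat_upt)
  next
    case False
    then have "(\<Sum>j<Suc i. length (g j)) \<le> (\<Sum>j<n. length (g j))"
      by (intro sum_mono2) (use Suc.prems in auto)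
    then show ?thesis using Suc False by (simp add: nth_append length_concat_upt)
  qed
qed simp

lemma ex_block_pos:
  assumes "x < (\<Sum>j<n. length (B j))"
  shows "\<exists>i<n. \<exists>k<length (B i). x = block_pos B i k"
  using assms
proof (induction n)
  case (Suc n)
  show ?case
  proof (cases "x < (\<Sum>j<n. length (B j))")
    case True
    then show ?thesis using Suc.IH less_SucI by blast
  next
    case False
    then have "x - (\<Sum>j<n. length (B j)) < length (B n) \<and>
        x = block_pos B n (x - (\<Sum>j<n. length (B j)))"
      using Suc.prems by (auto simp: block_pos_def)
    then show ?thesis by blast
  qed
qed simp

lemma length_inflation: "length (inflation p B) = (\<Sum>j<length p. length (B j))"
  unfolding inflation_def inflate_def by (subst length_concat_upt) simp

lemma block_pos_bound:
  assumes "i < length p" "k < length (B i)"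
  shows "block_pos B i k < length (inflation p B)"
  using block_pos_mono[where B = B and i' = "length p" and k' = 0, OF assms]
  by (simp add: length_inflation block_pos_def)

lemma inflation_pos_cases:
  assumes "x < length (inflation p B)"
  obtains i k where "i < length p" "k < length (B i)" "x = block_pos B i k"
  using ex_block_pos assms unfolding length_inflation by blast

lemma inflation_nth:
  assumes "i < length p" "k < length (B i)"
  shows "inflation p B ! block_pos B i k =
    B i ! k + (\<Sum>j | j < length p \<and> p ! j < p ! i. length (B j))"
proof -
  define off where
    "off i = (\<Sum>j | j < length p \<and> p ! j < p ! i. length (map B [0..<length p] ! j))" for i
  define g where "g i = map (\<lambda>v. v + off i) (map B [0..<length p] ! i)" for i
  have "off i = (\<Sum>j | j < length p \<and> p ! j < p ! i. length (B j))"
    unfolding off_def by (rule sum.cong) auto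
  moreover have "(\<Sum>j<i. length (g j)) = (\<Sum>j<i. length (B j))"
    using assms by (intro sum.cong) (auto simp: g_def)
  moreover have "inflation p B = concat (map g [0..<length p])"
    unfolding inflation_def inflate_def g_def[abs_def] off_def
    by (simp only: length_map length_upt minus_nat.diff_0)
  moreover have "k < length (g i)" "g i ! k = B i ! k + off i" using assms by (auto simp: g_def)
  ultimately show ?thesis using nth_concat_upt[of i "length p" k g] assms
    by (simp add: block_pos_def)
qed

lemma inflation_nth_less_iff:
  assumes p: "is_perm p" and B: "\<And>i. i < length p \<Longrightarrow> is_perm (B i)"
    and i: "i < length p" "k < length (B i)" and j: "j < length p" "l < length (B j)"
  shows "inflation p B ! block_pos B i k < inflation p B ! block_pos B j l \<longleftrightarrow>
    p ! i < p ! j \<or> i = j \<and> B i ! k < B i ! l"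
proof -
  have lt: "inflation p B ! block_pos B i k < inflation p B ! block_pos B j l"
    if ij: "i < length p" "k < length (B i)" "j < length p" "l < length (B j)" "p ! i < p ! j"
    for i j k l
  proof -
    have "B i ! k + (\<Sum>j | j < length p \<and> p ! j < p ! i. length (B j))
        \<le> length (B i) + (\<Sum>j | j < length p \<and> p ! j < p ! i. length (B j))"
      using perm_nth_bounds[OF B] ij by simp
    also have "\<dots> = (\<Sum>j\<in>insert i {j. j < length p \<and> p ! j < p ! i}. length (B j))" by simp
    also have "\<dots> \<le> (\<Sum>m | m < length p \<and> p ! m < p ! j. length (B m))"
      by (rule sum_mono2) (use ij in auto)
    also have "\<dots> < B j ! l + (\<Sum>m | m < length p \<and> p ! m < p ! j. length (B m))"
      using perm_nth_bounds(1)[OF B, of j l] ij by simp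
    finally show ?thesis using ij by (simp add: inflation_nth)
  qed
  show ?thesis
  proof (cases "i = j")
    case True
    then show ?thesis using i j by (simp add: inflation_nth)
  next
    case False
    then have "p ! i \<noteq> p ! j" using p i j by (simp add: perm_nth_eq_iff)
    then show ?thesis using lt[OF i j] lt[OF j i] False by (meson less_asym linorder_neqE_nat)
  qed
qed

text \<open>Blocks are non-empty, so an LR-minimum of the inflation beats an entry of every
  earlier block, and its block therefore sits on an LR-minimum.\<close>

lemma lr_min_inflation_iff:
  assumes p: "is_perm p" and B: "\<And>i. i < length p \<Longrightarrow> is_perm (B i)"
    and i: "i < length p" "k < length (B i)"
  shows "lr_min (inflation p B) (block_pos B i k) \<longleftrightarrow> lr_min p i \<and> lr_min (B i) k"
proof
  assume L: "lr_min (inflation p B) (block_pos B i k)"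
  have "p ! i < p ! j" if "j < i" for j
  proof -
    have j: "j < length p" using that i by simp
    then have 0: "0 < length (B j)" using B perm_length_pos by blast
    have "block_pos B j 0 < block_pos B i k" using that 0 by (rule block_pos_mono)
    then show ?thesis using L inflation_nth_less_iff[where B = B, OF p B i j 0] that
      by (auto simp: lr_min_def)
  qed
  moreover have "B i ! k < B i ! l" if "l < k" for l
  proof -
    have l: "l < length (B i)" using that i by simp
    have "block_pos B i l < block_pos B i k" using that by (simp add: block_pos_def)
    then show ?thesis using L inflation_nth_less_iff[where B = B, OF p B i i(1) l]
      by (auto simp: lr_min_def)
  qed
  ultimately show "lr_min p i \<and> lr_min (B i) k" using i by (simp add: lr_min_def)
next
  assume R: "lr_min p i \<and> lr_min (B i) k"
  have "inflation p B ! block_pos B i k < inflation p B ! x" if x: "x < block_pos B i k" for x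
  proof -
    have "x < length (inflation p B)" using x block_pos_bound[of i p k B] i by simp
    then obtain j l where jl: "j < length p" "l < length (B j)" "x = block_pos B j l"
      by (rule inflation_pos_cases)
    then show ?thesis using R x i block_pos_less_iff[where B = B, OF jl(2) i(2)]
        inflation_nth_less_iff[where B = B, OF p B i jl(1,2)] by (auto simp: lr_min_def)
  qed
  then show "lr_min (inflation p B) (block_pos B i k)"
    using block_pos_bound[of i p k B] i by (simp add: lr_min_def)
qed

text \<open>An embedding into the skeleton extends to the inflation by picking one entry of each
  block, because entries of different blocks compare as the inflated entries do.\<close>

lemma embedding_transversal:
  assumes q: "is_perm q" and B: "\<And>i. i < length q \<Longrightarrow> is_perm (B i)"
    and g: "embedding g t q" and c: "\<And>x. x < length t \<Longrightarrow> c x < length (B (g x))"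
  shows "embedding (\<lambda>x. block_pos B (g x) (c x)) t (inflation q B)"
proof (rule embeddingI)
  fix x assume "x < length t"
  then show "block_pos B (g x) (c x) < length (inflation q B)"
    using c embedding_bound[OF g] by (simp add: block_pos_bound)
next
  fix x y assume "x < y" "y < length t"
  then show "block_pos B (g x) (c x) < block_pos B (g y) (c y)"
    using c embedding_less_iff[OF g] by (simp add: block_pos_less_iff)
next
  fix x y assume xy: "x < length t" "y < length t"
  show "inflation q B ! block_pos B (g x) (c x) < inflation q B ! block_pos B (g y) (c y)
      \<longleftrightarrow> t ! x < t ! y"
    using xy c embedding_bound[OF g] embedding_nth_less_iff[OF g] embedding_eq_iff[OF g]
    by (subst inflation_nth_less_iff[OF q B]) auto
qed

lemma embedding_into_block:
  assumes q: "is_perm q" and B: "\<And>i. i < length q \<Longrightarrow> is_perm (B i)"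
    and i: "i < length q" and g: "embedding g t (B i)"
  shows "embedding (\<lambda>x. block_pos B i (g x)) t (inflation q B)"
proof (rule embeddingI)
  fix x assume "x < length t"
  then show "block_pos B i (g x) < length (inflation q B)"
    using i embedding_bound[OF g] by (simp add: block_pos_bound)
next
  fix x y assume "x < y" "y < length t"
  then show "block_pos B i (g x) < block_pos B i (g y)"
    using embedding_less_iff[OF g] by (simp add: block_pos_def)
next
  fix x y assume xy: "x < length t" "y < length t"
  show "inflation q B ! block_pos B i (g x) < inflation q B ! block_pos B i (g y)
      \<longleftrightarrow> t ! x < t ! y"
    using xy i embedding_bound[OF g] embedding_nth_less_iff[OF g]
    by (subst inflation_nth_less_iff[OF q B]) auto
qed

text \<open>The embedding acts blockwise.  Its values on pairs are returned as well, because images,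
  LR-minima and the amalgamation equation are all computed from them.\<close>

lemma ex_embedding_inflation:
  assumes p: "is_perm p" and A: "\<And>i. i < length p \<Longrightarrow> is_perm (A i)"
    and q: "is_perm q" and B: "\<And>i. i < length q \<Longrightarrow> is_perm (B i)"
    and f: "embedding f p q" and h: "\<And>i. i < length p \<Longrightarrow> embedding (h i) (A i) (B (f i))"
  obtains e where "embedding e (inflation p A) (inflation q B)"
    and "\<And>i k. i < length p \<Longrightarrow> k < length (A i) \<Longrightarrow>
      e (block_pos A i k) = block_pos B (f i) (h i k)"
proof -
  define e where "e x = (THE y. \<exists>i k. i < length p \<and> k < length (A i) \<and> x = block_pos A i k \<and>
      y = block_pos B (f i) (h i k))" for x
  have e: "e (block_pos A i k) = block_pos B (f i) (h i k)"
    if "i < length p" "k < length (A i)" for i k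
    unfolding e_def using that by (intro the_equality) (auto simp: block_pos_eq_iff)
  have "embedding e (inflation p A) (inflation q B)"
  proof (rule embeddingI)
    fix x assume "x < length (inflation p A)"
    then obtain i k where ik: "i < length p" "k < length (A i)" "x = block_pos A i k"
      by (rule inflation_pos_cases)
    then show "e x < length (inflation q B)"
      using embedding_bound[OF f] embedding_bound[OF h] by (simp add: e block_pos_bound)
  next
    fix x y assume xy: "x < y" "y < length (inflation p A)"
    then have "x < length (inflation p A)" by simp
    then obtain i k where ik: "i < length p" "k < length (A i)" "x = block_pos A i k"
      by (rule inflation_pos_cases)
    obtain j l where jl: "j < length p" "l < length (A j)" "y = block_pos A j l"
      using xy(2) by (rule inflation_pos_cases)
    have "i < j \<or> i = j \<and> k < l" using xy(1) ik jl by (simp add: block_pos_less_iff)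
    then show "e x < e y"
      using ik jl embedding_bound[OF h] embedding_less_iff[OF f] embedding_less_iff[OF h]
      by (auto simp: e block_pos_less_iff)
  next
    fix x y assume xy: "x < length (inflation p A)" "y < length (inflation p A)"
    obtain i k where ik: "i < length p" "k < length (A i)" "x = block_pos A i k"
      using xy(1) by (rule inflation_pos_cases)
    obtain j l where jl: "j < length p" "l < length (A j)" "y = block_pos A j l"
      using xy(2) by (rule inflation_pos_cases)
    have ex: "e x = block_pos B (f i) (h i k)" "e y = block_pos B (f j) (h j l)"
      using e ik jl by auto
    have b: "f i < length q" "h i k < length (B (f i))" "f j < length q" "h j l < length (B (f j))"
      using ik jl embedding_bound[OF f] embedding_bound[OF h] by auto
    have "inflation q B ! e x < inflation q B ! e y \<longleftrightarrow>
        q ! f i < q ! f j \<or> f i = f j \<and> B (f i) ! h i k < B (f i) ! h j l"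
      unfolding ex by (rule inflation_nth_less_iff[where B = B, OF q B b])
    also have "\<dots> \<longleftrightarrow> p ! i < p ! j \<or> i = j \<and> A i ! k < A i ! l"
      using ik jl embedding_nth_less_iff[OF f] embedding_eq_iff[OF f]
        embedding_nth_less_iff[OF h] by auto
    also have "\<dots> \<longleftrightarrow> inflation p A ! x < inflation p A ! y"
      unfolding ik jl by (rule inflation_nth_less_iff[where B = A, OF p A ik(1,2) jl(1,2), symmetric])
    finally show "inflation q B ! e x < inflation q B ! e y \<longleftrightarrow> inflation p A ! x < inflation p A ! y" .
  qed
  then show thesis using that e by blast
qed


section \<open>LR-inflations\<close>

definition lr_blocks :: "nat list \<Rightarrow> (nat \<Rightarrow> nat list) \<Rightarrow> nat \<Rightarrow> nat list" where
  "lr_blocks p S i = (if lr_min p i then S i else [1])"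

abbreviation lr_inflation :: "nat list \<Rightarrow> (nat \<Rightarrow> nat list) \<Rightarrow> nat list" where
  "lr_inflation p S \<equiv> inflation p (lr_blocks p S)"

lemma is_perm_lr_blocks:
  "(\<And>i. lr_min p i \<Longrightarrow> is_perm (S i)) \<Longrightarrow> is_perm (lr_blocks p S i)"
  by (simp add: lr_blocks_def is_perm_def)

lemma finite_lr_min: "finite {i. lr_min p i}"
  by (rule finite_subset[of _ "{..<length p}"]) (auto simp: lr_min_def)

lemma lr_inflate_eq_lr_inflation:
  "lr_inflate p ss = lr_inflation p (\<lambda>i. ss ! card {j. j < i \<and> lr_min p j})"
  by (simp add: lr_inflate_def inflation_def lr_blocks_def[abs_def])

lemma sorted_list_of_set_nth_card:
  assumes fin: "finite A" and i: "i \<in> A"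
  shows "sorted_list_of_set A ! card {j \<in> A. j < i} = i"
proof -
  let ?xs = "sorted_list_of_set A"
  have xs: "sorted_wrt (<) ?xs" "set ?xs = A" "distinct ?xs" using fin by auto
  obtain m where m: "m < length ?xs" "?xs ! m = i" using xs(2) i by (metis in_set_conv_nth)
  have lt: "?xs ! a < ?xs ! b \<longleftrightarrow> a < b" if "a < length ?xs" "b < length ?xs" for a b
    using xs(1) that unfolding sorted_wrt_iff_nth_less by (metis less_asym linorder_neqE_nat)
  have "{j \<in> A. j < i} = (!) ?xs ` {..<m}"
  proof
    show "(!) ?xs ` {..<m} \<subseteq> {j \<in> A. j < i}" using m lt xs(2) nth_mem by fastforce
    show "{j \<in> A. j < i} \<subseteq> (!) ?xs ` {..<m}"
    proof
      fix j assume j: "j \<in> {j \<in> A. j < i}"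
      then have "j \<in> set ?xs" using xs(2) by simp
      then obtain a where "a < length ?xs" "?xs ! a = j" by (auto simp: in_set_conv_nth)
      then show "j \<in> (!) ?xs ` {..<m}" using j m lt by auto
    qed
  qed
  moreover have "inj_on ((!) ?xs) {..<m}"
    using xs(3) m by (auto simp: inj_on_def nth_eq_iff_index_eq)
  ultimately show ?thesis using m by (simp add: card_image)
qed

text \<open>Listing the blocks by increasing LR-minima turns a family indexed by positions into the list
  expected by \<open>lr_inflate\<close>.\<close>

lemma lr_inflation_mem:
  assumes D: "closed_under_lr_inflations D" and p: "p \<in> D"
    and S: "\<And>i. lr_min p i \<Longrightarrow> S i \<in> D"
  shows "lr_inflation p S \<in> D"
proof -
  let ?xs = "sorted_list_of_set {i. lr_min p i}"
  define ss where "ss = map S ?xs"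
  have len: "length ss = card {i. lr_min p i}" by (simp add: ss_def)
  have "ss ! card {j. j < i \<and> lr_min p j} = S i" if i: "lr_min p i" for i
  proof -
    have "card {j. j < i \<and> lr_min p j} < card {i. lr_min p i}"
      by (rule psubset_card_mono[OF finite_lr_min]) (use i in auto)
    moreover have "?xs ! card {j. j < i \<and> lr_min p j} = i"
      using sorted_list_of_set_nth_card[OF finite_lr_min, of i p] i by (simp add: conj_commute)
    ultimately show ?thesis by (simp add: ss_def)
  qed
  then have "lr_inflate p ss = lr_inflation p S"
    unfolding lr_inflate_eq_lr_inflation by (intro inflation_cong) (simp add: lr_blocks_def)
  moreover have "set ss \<subseteq> D" using S finite_lr_min by (auto simp: ss_def)
  ultimately show ?thesis using D p len unfolding closed_under_lr_inflations_def by metis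
qed


section \<open>Generating the LR-closure by inflations alone\<close>

text \<open>There is no rule for subpermutations because such a rule would break the induction for
  amalgamability: a subpermutation may have LR-minima that are not LR-minima of the whole
  permutation, and an amalgam of the whole permutation need not preserve these.\<close>

inductive_set lr_generated :: "nat list set \<Rightarrow> nat list set" for C where
  base: "p \<in> C \<Longrightarrow> p \<in> lr_generated C"
| inflate: "p \<in> lr_generated C \<Longrightarrow> (\<And>i. lr_min p i \<Longrightarrow> S i \<in> lr_generated C)
    \<Longrightarrow> lr_inflation p S \<in> lr_generated C"

context
  fixes C
  assumes C: "perm_class C"
begin

lemma is_perm_lr_generated: "p \<in> lr_generated C \<Longrightarrow> is_perm p"
proof (induction rule: lr_generated.induct)
  case (base p)
  then show ?case using C by (auto simp: perm_class_def)
next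
  case (inflate p S)
  then show ?case by (intro is_perm_inflation is_perm_lr_blocks)
qed

lemma singleton_lr_generated:
  assumes "p \<in> lr_generated C"
  shows "[1] \<in> lr_generated C"
  using assms
proof (induction rule: lr_generated.induct)
  case (base p)
  then have "embedding id [1] p" using C
    by (auto simp: embedding_singleton_iff perm_class_def is_perm_def)
  then have "[1] \<in> C" using C base is_perm_singleton unfolding perm_class_def contains_def by blast
  then show ?case by (rule lr_generated.base)
qed

text \<open>A subpermutation of an LR-inflation is an LR-inflation of the subpermutation formed by the
  blocks that it meets, by the parts of these blocks.  A surviving LR-minimum of the skeleton stays
  one.  An entry that only becomes an LR-minimum was not inflated, and its block is a singleton.\<close>

lemma lr_generated_subpermutation:
  assumes "t \<in> lr_generated C" "is_perm s" "contains t s"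
  shows "s \<in> lr_generated C"
  using assms
proof (induction arbitrary: s rule: lr_generated.induct)
  case (base p)
  then have "s \<in> C" using C unfolding perm_class_def by blast
  then show ?case by (rule lr_generated.base)
next
  case (inflate p S)
  define B where "B = lr_blocks p S"
  have p: "is_perm p" using inflate.hyps(1) by (rule is_perm_lr_generated)
  have B: "is_perm (B i)" for i
    unfolding B_def
    by (intro is_perm_lr_blocks is_perm_lr_generated inflate.hyps(2))
  obtain e where e: "embedding e s (inflation p B)"
    using inflate.prems by (auto simp: contains_def B_def)
  define A where "A = e ` {..<length s}"
  have Asub: "x < length (inflation p B)" if "x \<in> A" for x
    using that embedding_bound[OF e] by (auto simp: A_def)
  define K where "K i = {k. k < length (B i) \<and> block_pos B i k \<in> A}" for i
  define I where "I = {i. i < length p \<and> K i \<noteq> {}}"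
  have cover: "\<exists>i\<in>I. \<exists>k\<in>K i. x = block_pos B i k" if "x \<in> A" for x
  proof -
    obtain i k where ik: "i < length p" "k < length (B i)" "x = block_pos B i k"
      using Asub[OF \<open>x \<in> A\<close>] by (rule inflation_pos_cases)
    then have "k \<in> K i" using \<open>x \<in> A\<close> by (simp add: K_def)
    moreover have "i \<in> I" using ik(1) calculation by (auto simp: I_def)
    ultimately show ?thesis using ik(3) by blast
  qed
  have "e 0 \<in> A" using inflate.prems(1) by (auto simp: A_def is_perm_def)
  then have "I \<noteq> {}" using cover by blast
  then obtain p' f where p': "is_perm p'" "embedding f p' p" "f ` {..<length p'} = I"
    using ex_restriction[OF p, of I] by (auto simp: I_def)
  have fI: "f j \<in> I" if "j < length p'" for j using p'(3) that by auto
  have "\<forall>j. \<exists>b h. j < length p' \<longrightarrow>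
      is_perm b \<and> embedding h b (B (f j)) \<and> h ` {..<length b} = K (f j)"
  proof
    fix j
    show "\<exists>b h. j < length p' \<longrightarrow>
        is_perm b \<and> embedding h b (B (f j)) \<and> h ` {..<length b} = K (f j)"
    proof (cases "j < length p'")
      case True
      then have "K (f j) \<noteq> {}" "K (f j) \<subseteq> {..<length (B (f j))}"
        using fI by (auto simp: I_def K_def)
      then show ?thesis using ex_restriction[OF B] by metis
    qed simp
  qed
  then obtain b h where bh: "\<And>j. j < length p' \<Longrightarrow> is_perm (b j)"
      "\<And>j. j < length p' \<Longrightarrow> embedding (h j) (b j) (B (f j))"
      "\<And>j. j < length p' \<Longrightarrow> h j ` {..<length (b j)} = K (f j)"
    by metis
  obtain e' where e': "embedding e' (inflation p' b) (inflation p B)"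
    and e'_pos: "\<And>j k. j < length p' \<Longrightarrow> k < length (b j) \<Longrightarrow>
      e' (block_pos b j k) = block_pos B (f j) (h j k)"
    using ex_embedding_inflation[where A = b and B = B and f = f and h = h,
        OF p'(1) bh(1) p B p'(2) bh(2)] by blast
  \<comment> \<open>The rebuilt inflation occupies the same positions as \<open>s\<close>, so it is \<open>s\<close>.\<close>
  have "e' ` {..<length (inflation p' b)} = A"
  proof
    show "e' ` {..<length (inflation p' b)} \<subseteq> A"
    proof clarify
      fix x assume "x < length (inflation p' b)"
      then obtain j k where jk: "j < length p'" "k < length (b j)" "x = block_pos b j k"
        by (rule inflation_pos_cases)
      then have "h j k \<in> K (f j)" using bh(3) by blast
      then show "e' x \<in> A" using e'_pos jk by (simp add: K_def)
    qed
    show "A \<subseteq> e' ` {..<length (inflation p' b)}"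
    proof
      fix x assume "x \<in> A"
      then obtain i k where ik: "i \<in> I" "k \<in> K i" "x = block_pos B i k" using cover by blast
      then obtain j where j: "j < length p'" "i = f j" using p'(3) by auto
      then obtain l where l: "l < length (b j)" "k = h j l" using ik bh(3) by blast
      then have "x = e' (block_pos b j l)" using e'_pos j ik by simp
      then show "x \<in> e' ` {..<length (inflation p' b)}" using block_pos_bound[of j p' l b] j l by auto
    qed
  qed
  then have s: "s = inflation p' b"
    using perm_eq_if_same_image[OF inflate.prems(1) e
        is_perm_inflation[where B = b, OF p'(1) bh(1)] e']
    by (simp add: A_def)
  have b_single: "b j = [1]" if j: "j < length p'" "\<not> lr_min p (f j)" for j
  proof -
    have "K (f j) \<subseteq> {0}" using j by (auto simp: K_def B_def lr_blocks_def)
    then have h0: "h j k = 0" if "k < length (b j)" for k using bh(3)[OF j(1)] that by blast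
    have "\<not> 1 < length (b j)"
    proof
      assume 1: "1 < length (b j)"
      then have 0: "0 < length (b j)" by linarith
      show False using embedding_eq_iff[OF bh(2)[OF j(1)] 0 1] h0[OF 0] h0[OF 1] by simp
    qed
    then have "length (b j) \<le> 1" by simp
    then show ?thesis by (rule perm_of_length_one[OF bh(1)[OF j(1)]])
  qed
  have "b j \<in> lr_generated C" if "lr_min p' j" for j
  proof (cases "lr_min p (f j)")
    case True
    have j: "j < length p'" using that by (simp add: lr_min_def)
    then have "contains (S (f j)) (b j)"
      using bh(2)[OF j] True by (auto simp: contains_def B_def lr_blocks_def)
    then show ?thesis using inflate.IH(2)[OF True] bh(1) j by blast
  next
    case False
    then show ?thesis using b_single that singleton_lr_generated[OF inflate.hyps(1)]
      by (simp add: lr_min_def)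
  qed
  moreover have "p' \<in> lr_generated C" using inflate.IH(1) p' by (auto simp: contains_def)
  moreover have "s = lr_inflation p' b"
    unfolding s using b_single lr_min_if_embedding[OF p'(2)]
    by (intro inflation_cong) (auto simp: lr_blocks_def)
  ultimately show ?case by (simp add: lr_generated.inflate)
qed

lemma lr_closure_eq_lr_generated: "lr_closure C = lr_generated C"
proof
  have "perm_class (lr_generated C)"
    unfolding perm_class_def using is_perm_lr_generated lr_generated_subpermutation by blast
  moreover have "C \<subseteq> lr_generated C" by (auto intro: lr_generated.base)
  moreover have "closed_under_lr_inflations (lr_generated C)"
    unfolding closed_under_lr_inflations_def lr_inflate_eq_lr_inflation
  proof (intro ballI allI impI lr_generated.inflate)
    fix p ss i
    assume ss: "length ss = card {i. lr_min p i} \<and> set ss \<subseteq> lr_generated C" and i: "lr_min p i"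
    have "card {j. j < i \<and> lr_min p j} < card {i. lr_min p i}"
      by (rule psubset_card_mono[OF finite_lr_min]) (use i in auto)
    then show "ss ! card {j. j < i \<and> lr_min p j} \<in> lr_generated C"
      using ss by (metis nth_mem subsetD)
  qed
  ultimately show "lr_closure C \<subseteq> lr_generated C" by (rule lr_closure_least(4)[OF C])
  show "lr_generated C \<subseteq> lr_closure C"
  proof
    fix p assume "p \<in> lr_generated C"
    then show "p \<in> lr_closure C"
    proof (induction rule: lr_generated.induct)
      case (base p)
      then show ?case using lr_closure_least(2)[OF C] by blast
    next
      case (inflate p S)
      then show ?case by (intro lr_inflation_mem lr_closure_least(3)[OF C])
    qed
  qed
qed

end


section \<open>Amalgamation\<close>

definition lr_embedding :: "(nat \<Rightarrow> nat) \<Rightarrow> nat list \<Rightarrow> nat list \<Rightarrow> bool" where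
  "lr_embedding g t s \<longleftrightarrow> embedding g t s \<and> (\<forall>i. lr_min t i \<longrightarrow> lr_min s (g i))"

definition amalgamable_in :: "nat list set \<Rightarrow> nat list \<Rightarrow> nat list \<Rightarrow> bool" where
  "amalgamable_in D t1 t2 \<longleftrightarrow>
    (\<forall>a1<length t1. \<forall>a2<length t2. \<not> lr_min t1 a1 \<longrightarrow> \<not> lr_min t2 a2 \<longrightarrow>
      (\<exists>s\<in>D. \<exists>g1 g2. lr_embedding g1 t1 s \<and> lr_embedding g2 t2 s \<and> g1 a1 = g2 a2))"

lemma amalgamable_inD:
  assumes "amalgamable_in D t1 t2" "a1 < length t1" "a2 < length t2"
    "\<not> lr_min t1 a1" "\<not> lr_min t2 a2"
  obtains s g1 g2 where "s \<in> D" "lr_embedding g1 t1 s" "lr_embedding g2 t2 s" "g1 a1 = g2 a2"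
  using assms unfolding amalgamable_in_def by blast

lemma amalgamable_in_sym:
  assumes "amalgamable_in D t1 t2"
  shows "amalgamable_in D t2 t1"
  unfolding amalgamable_in_def
proof (intro allI impI)
  fix a2 a1
  assume "a2 < length t2" "a1 < length t1" "\<not> lr_min t2 a2" "\<not> lr_min t1 a1"
  then obtain s g1 g2 where "s \<in> D" "lr_embedding g1 t1 s" "lr_embedding g2 t2 s" "g1 a1 = g2 a2"
    using amalgamable_inD[OF assms] by blast
  then show "\<exists>s\<in>D. \<exists>g2 g1. lr_embedding g2 t2 s \<and> lr_embedding g1 t1 s \<and> g2 a2 = g1 a1"
    by (intro bexI[of _ s] exI[of _ g1] exI[of _ g2]) simp_all
qed

lemma amalgamable_in_mono: "D \<subseteq> D' \<Longrightarrow> amalgamable_in D t1 t2 \<Longrightarrow> amalgamable_in D' t1 t2"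
  unfolding amalgamable_in_def by blast

lemma lr_amalgamable_iff:
  "lr_amalgamable D \<longleftrightarrow> (\<forall>t1\<in>D. \<forall>t2\<in>D. amalgamable_in D t1 t2)"
proof
  assume am: "lr_amalgamable D"
  show "\<forall>t1\<in>D. \<forall>t2\<in>D. amalgamable_in D t1 t2"
    unfolding amalgamable_in_def
  proof (intro ballI allI impI)
    fix t1 t2 a1 a2
    assume "t1 \<in> D" "t2 \<in> D" "a1 < length t1" "a2 < length t2"
      "\<not> lr_min t1 a1" "\<not> lr_min t2 a2"
    then obtain s g1 g2 where "s \<in> D" "embedding g1 t1 s" "embedding g2 t2 s" "g1 a1 = g2 a2"
        "\<forall>i. lr_min t1 i \<longrightarrow> lr_min s (g1 i)" "\<forall>i. lr_min t2 i \<longrightarrow> lr_min s (g2 i)"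
      using am[unfolded lr_amalgamable_def embedding_singleton_iff comp_apply, rule_format,
          of t1 t2 "\<lambda>_. a1" "\<lambda>_. a2"] by metis
    then show "\<exists>s\<in>D. \<exists>g1 g2. lr_embedding g1 t1 s \<and> lr_embedding g2 t2 s \<and> g1 a1 = g2 a2"
      unfolding lr_embedding_def by (intro bexI[of _ s] exI[of _ g1] exI[of _ g2] conjI)
  qed
next
  assume am: "\<forall>t1\<in>D. \<forall>t2\<in>D. amalgamable_in D t1 t2"
  show "lr_amalgamable D"
    unfolding lr_amalgamable_def embedding_singleton_iff comp_apply
  proof (intro ballI allI impI, elim conjE)
    fix t1 t2 and f1 f2 :: "nat \<Rightarrow> nat"
    assume "t1 \<in> D" "t2 \<in> D" "f1 0 < length t1" "f2 0 < length t2"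
      "\<not> lr_min t1 (f1 0)" "\<not> lr_min t2 (f2 0)"
    then obtain s g1 g2 where s: "s \<in> D" "lr_embedding g1 t1 s" "lr_embedding g2 t2 s"
        "g1 (f1 0) = g2 (f2 0)"
      using amalgamable_inD[of D t1 t2] am by blast
    show "\<exists>s\<in>D. \<exists>g1 g2. embedding g1 t1 s \<and> embedding g2 t2 s \<and> g1 (f1 0) = g2 (f2 0) \<and>
        (\<forall>i. lr_min t1 i \<longrightarrow> lr_min s (g1 i)) \<and> (\<forall>i. lr_min t2 i \<longrightarrow> lr_min s (g2 i))"
      using s(2-4) unfolding lr_embedding_def
      by (intro bexI[OF _ s(1)] exI[of _ g1] exI[of _ g2]) simp
  qed
qed

text \<open>The maps between blocks need to preserve LR-minima only over LR-minima of the skeleton;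
  other blocks contain no LR-minima of the inflation.\<close>

lemma ex_lr_embedding_inflation:
  assumes p: "is_perm p" and A: "\<And>i. i < length p \<Longrightarrow> is_perm (A i)"
    and q: "is_perm q" and B: "\<And>i. i < length q \<Longrightarrow> is_perm (B i)"
    and f: "lr_embedding f p q"
    and h: "\<And>i. i < length p \<Longrightarrow> embedding (h i) (A i) (B (f i))"
    and h_lr: "\<And>i k. lr_min p i \<Longrightarrow> lr_min (A i) k \<Longrightarrow> lr_min (B (f i)) (h i k)"
  obtains e where "lr_embedding e (inflation p A) (inflation q B)"
    and "\<And>i k. i < length p \<Longrightarrow> k < length (A i) \<Longrightarrow>
      e (block_pos A i k) = block_pos B (f i) (h i k)"
proof -
  have f': "embedding f p q" using f by (simp add: lr_embedding_def)
  obtain e where e: "embedding e (inflation p A) (inflation q B)"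
    and e_pos: "\<And>i k. i < length p \<Longrightarrow> k < length (A i) \<Longrightarrow>
      e (block_pos A i k) = block_pos B (f i) (h i k)"
    using ex_embedding_inflation[where A = A and B = B and f = f and h = h, OF p A q B f' h] by blast
  have "lr_min (inflation q B) (e x)" if x: "lr_min (inflation p A) x" for x
  proof -
    have "x < length (inflation p A)" using x by (simp add: lr_min_def)
    then obtain i k where ik: "i < length p" "k < length (A i)" "x = block_pos A i k"
      by (rule inflation_pos_cases)
    have lr: "lr_min p i" "lr_min (A i) k"
      using x lr_min_inflation_iff[where B = A, OF p A ik(1,2)] ik(3) by simp_all
    have lr': "lr_min q (f i)" "lr_min (B (f i)) (h i k)"
      using f lr(1) h_lr[OF lr] by (simp_all add: lr_embedding_def)
    have fi: "f i < length q" using f' ik(1) by (rule embedding_bound)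
    have hik: "h i k < length (B (f i))" using h[OF ik(1)] ik(2) by (rule embedding_bound)
    show ?thesis
      using lr' lr_min_inflation_iff[where B = B, OF q B fi hik] e_pos[OF ik(1,2)] ik(3) by simp
  qed
  then have "lr_embedding e (inflation p A) (inflation q B)" using e by (simp add: lr_embedding_def)
  then show thesis using e_pos by (rule that)
qed

text \<open>The induction step.  Each amalgam is again an LR-inflation: of \<open>p\<close> if the chosen entry lies
  in a block on an LR-minimum, of an amalgam of \<open>p\<close> and \<open>t\<close> otherwise.\<close>

lemma amalgamable_in_lr_inflation:
  assumes D: "\<And>p. p \<in> D \<Longrightarrow> is_perm p" "[1] \<in> D"
    and D_inflate: "\<And>p S. p \<in> D \<Longrightarrow> (\<And>i. lr_min p i \<Longrightarrow> S i \<in> D) \<Longrightarrow> lr_inflation p S \<in> D"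
    and p: "p \<in> D" and S: "\<And>i. lr_min p i \<Longrightarrow> S i \<in> D"
    and p_am: "amalgamable_in D p t" and S_am: "\<And>i. lr_min p i \<Longrightarrow> amalgamable_in D (S i) t"
  shows "amalgamable_in D (lr_inflation p S) t"
  unfolding amalgamable_in_def
proof (intro allI impI)
  let ?A = "lr_blocks p S"
  fix a c
  assume a: "a < length (lr_inflation p S)" and c: "c < length t"
    and a_lr: "\<not> lr_min (lr_inflation p S) a" and c_lr: "\<not> lr_min t c"
  have pp: "is_perm p" using D p by blast
  have A: "is_perm (?A i)" for i using D S by (intro is_perm_lr_blocks) blast
  obtain i k where ik: "i < length p" "k < length (?A i)" "a = block_pos ?A i k"
    using a by (rule inflation_pos_cases)
  show "\<exists>s\<in>D. \<exists>g1 g2. lr_embedding g1 (lr_inflation p S) s \<and> lr_embedding g2 t s \<and> g1 a = g2 c"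
  proof (cases "lr_min p i")
    case True
    then have Ai: "?A i = S i" by (simp add: lr_blocks_def)
    then have "\<not> lr_min (S i) k" using a_lr ik True lr_min_inflation_iff[where B = ?A, OF pp A, of i k]
      by simp
    then obtain r g1 g2 where r: "r \<in> D" and g1: "lr_embedding g1 (S i) r"
      and g2: "lr_embedding g2 t r" and eq: "g1 k = g2 c"
      using amalgamable_inD[OF S_am[OF True] _ c _ c_lr] ik(2) Ai by metis
    let ?B = "lr_blocks p (S(i := r))"
    have B: "is_perm (?B j)" for j using D S r by (intro is_perm_lr_blocks) auto
    have Bi: "?B i = r" using True by (simp add: lr_blocks_def)
    have Bj: "?B j = ?A j" if "j \<noteq> i" for j using that by (simp add: lr_blocks_def)
    have id: "lr_embedding (\<lambda>j. j) p p" by (simp add: lr_embedding_def embedding_id)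
    obtain e where e: "lr_embedding e (lr_inflation p S) (inflation p ?B)"
      and e_pos: "\<And>j l. j < length p \<Longrightarrow> l < length (?A j) \<Longrightarrow>
        e (block_pos ?A j l) = block_pos ?B j (if j = i then g1 l else l)"
    proof (rule ex_lr_embedding_inflation[where A = ?A and B = ?B and f = "\<lambda>j. j"
          and h = "\<lambda>j l. if j = i then g1 l else l", OF pp A pp B id])
      show "embedding (\<lambda>l. if j = i then g1 l else l) (?A j) (?B j)" for j
        using g1 Ai Bi Bj by (cases "j = i") (auto simp: lr_embedding_def embedding_id)
      show "lr_min (?B j) (if j = i then g1 l else l)" if "lr_min (?A j) l" for j l
        using that g1 Ai Bi Bj by (cases "j = i") (auto simp: lr_embedding_def)
    qed blast
    have "lr_embedding (\<lambda>x. block_pos ?B i (g2 x)) t (inflation p ?B)"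
    proof -
      have g2e: "embedding g2 t (?B i)" using g2 Bi by (simp add: lr_embedding_def)
      have "lr_min (inflation p ?B) (block_pos ?B i (g2 x))" if x: "lr_min t x" for x
      proof -
        have "x < length t" using x by (simp add: lr_min_def)
        then show ?thesis using lr_min_inflation_iff[where B = ?B, OF pp B ik(1)] embedding_bound[OF g2e]
            True g2 x Bi by (simp add: lr_embedding_def)
      qed
      then show ?thesis using embedding_into_block[where B = ?B, OF pp B ik(1) g2e]
        by (simp add: lr_embedding_def)
    qed
    moreover have "e a = block_pos ?B i (g2 c)" using ik e_pos eq by simp
    moreover have "inflation p ?B \<in> D" using S r by (intro D_inflate p) auto
    ultimately show ?thesis using e by blast
  next
    case False
    then obtain r g1 g2 where r: "r \<in> D" and g1: "lr_embedding g1 p r"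
      and g2: "lr_embedding g2 t r" and eq: "g1 i = g2 c"
      using amalgamable_inD[OF p_am ik(1) c _ c_lr] by metis
    have rp: "is_perm r" using D r by blast
    have g1e: "embedding g1 p r" and g2e: "embedding g2 t r"
      using g1 g2 by (auto simp: lr_embedding_def)
    \<comment> \<open>\<open>R\<close> transports the blocks along \<open>g1\<close>; LR-minima of \<open>r\<close> that do not come from LR-minima
      of \<open>p\<close> stay uninflated.\<close>
    define R where "R m = (if \<exists>j. lr_min p j \<and> g1 j = m
        then S (SOME j. lr_min p j \<and> g1 j = m) else [1])" for m
    have R_g1: "R (g1 j) = S j" if j: "lr_min p j" for j
    proof -
      have "(SOME j'. lr_min p j' \<and> g1 j' = g1 j) = j"
        by (rule some_equality) (use j embedding_eq_iff[OF g1e] in \<open>auto simp: lr_min_def\<close>)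
      then show ?thesis using j by (auto simp: R_def)
    qed
    have R: "R m \<in> D" for m
    proof (cases "\<exists>j. lr_min p j \<and> g1 j = m")
      case True
      then show ?thesis using R_g1 S by metis
    next
      case False
      then have "R m = [1]" unfolding R_def by (rule if_not_P)
      then show ?thesis using D(2) by simp
    qed
    let ?B = "lr_blocks r R"
    have B: "is_perm (?B j)" for j using D R by (intro is_perm_lr_blocks) blast
    have B0: "0 < length (?B j)" for j using B perm_length_pos by blast
    have B_lr: "?B (g1 j) = ?A j" if "lr_min p j" for j
      using that g1 R_g1 by (simp add: lr_blocks_def lr_embedding_def)
    have A_not_lr: "?A j = [1]" if "\<not> lr_min p j" for j using that by (simp add: lr_blocks_def)
    obtain e where e: "lr_embedding e (lr_inflation p S) (inflation r ?B)"
      and e_pos: "\<And>j l. j < length p \<Longrightarrow> l < length (?A j) \<Longrightarrow>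
        e (block_pos ?A j l) = block_pos ?B (g1 j) l"
    \<comment> \<open>Over an entry that is not an LR-minimum the block is a singleton, and the identity
      sends it to the first entry of the target block.\<close>
    proof (rule ex_lr_embedding_inflation[where A = ?A and B = ?B and f = g1
          and h = "\<lambda>j l. l", OF pp A rp B g1])
      show "embedding (\<lambda>l. l) (?A j) (?B (g1 j))" for j
        using B_lr A_not_lr B0
        by (cases "lr_min p j") (simp_all add: embedding_id embedding_singleton_iff)
      show "lr_min (?B (g1 j)) l" if "lr_min p j" "lr_min (?A j) l" for j l
        using that B_lr by simp
    qed blast
    have "lr_embedding (\<lambda>x. block_pos ?B (g2 x) 0) t (inflation r ?B)"
    proof -
      have "lr_min (inflation r ?B) (block_pos ?B (g2 x) 0)" if x: "lr_min t x" for x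
      proof -
        have "x < length t" using x by (simp add: lr_min_def)
        then show ?thesis using lr_min_inflation_iff[where B = ?B, OF rp B _ B0] embedding_bound[OF g2e]
            g2 x lr_min_0[OF B] by (simp add: lr_embedding_def)
      qed
      then show ?thesis
        using embedding_transversal[where B = ?B and c = "\<lambda>_. 0", OF rp B g2e B0]
        by (simp add: lr_embedding_def)
    qed
    moreover have "e a = block_pos ?B (g2 c) 0" using ik e_pos eq A_not_lr[OF False] by simp
    moreover have "inflation r ?B \<in> D" using R by (intro D_inflate r)
    ultimately show ?thesis using e by blast
  qed
qed

text \<open>Amalgamability is symmetric, so the same step serves both arguments: members of \<open>C\<close> are
  treated first against generated permutations, then the first argument is generated too.\<close>

lemma lr_amalgamable_lr_generated:
  assumes C: "perm_class C" and am: "lr_amalgamable C"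
  shows "lr_amalgamable (lr_generated C)"
proof -
  let ?D = "lr_generated C"
  have step: "amalgamable_in ?D (lr_inflation p S) t"
    if "p \<in> ?D" "\<And>i. lr_min p i \<Longrightarrow> S i \<in> ?D" "amalgamable_in ?D p t"
      "\<And>i. lr_min p i \<Longrightarrow> amalgamable_in ?D (S i) t" for p S t
    by (rule amalgamable_in_lr_inflation)
      (use that is_perm_lr_generated[OF C] singleton_lr_generated[OF C] lr_generated.inflate in blast)+
  have sub: "C \<subseteq> ?D" by (auto intro: lr_generated.base)
  have C_D: "amalgamable_in ?D t1 t2" if t1: "t1 \<in> C" and t2: "t2 \<in> ?D" for t1 t2
    using t2
  proof (induction rule: lr_generated.induct)
    case (base t2)
    then show ?case using am t1 amalgamable_in_mono[OF sub] by (simp add: lr_amalgamable_iff)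
  next
    case (inflate p S)
    have "amalgamable_in ?D (lr_inflation p S) t1"
      by (rule step[OF inflate.hyps]) (simp_all add: inflate.IH amalgamable_in_sym)
    then show ?case by (rule amalgamable_in_sym)
  qed
  have "amalgamable_in ?D t1 t2" if t1: "t1 \<in> ?D" and t2: "t2 \<in> ?D" for t1 t2
    using t1
  proof (induction rule: lr_generated.induct)
    case (base t1)
    then show ?case using C_D t2 by blast
  next
    case (inflate p S)
    then show ?case by (intro step)
  qed
  then show ?thesis by (simp add: lr_amalgamable_iff)
qed

text \<open>Inflating the chosen LR-minimum of \<open>t1\<close> by \<open>t2\<close> gives the amalgam: \<open>t2\<close> is the block, and
  \<open>t1\<close> is the transversal through the chosen entry \<open>a2\<close> of this block.\<close>

lemma ex_amalgam_at_lr_min: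
  assumes D: "perm_class D" "closed_under_lr_inflations D"
    and t: "t1 \<in> D" "t2 \<in> D" and a: "lr_min t1 a1" "a2 < length t2"
  shows "\<exists>s\<in>D. \<exists>g1 g2. embedding g1 t1 s \<and> embedding g2 t2 s \<and> g1 a1 = g2 a2"
proof -
  have perm: "is_perm t1" "is_perm t2" using D(1) t unfolding perm_class_def by blast+
  let ?B = "lr_blocks t1 ((\<lambda>_. [1])(a1 := t2))"
  have B: "is_perm (?B i)" for i using perm by (intro is_perm_lr_blocks) (auto simp: is_perm_def)
  have B0: "0 < length (?B i)" for i using B perm_length_pos by blast
  have Ba: "?B a1 = t2" using a by (simp add: lr_blocks_def)
  have a1: "a1 < length t1" using a by (simp add: lr_min_def)
  have "embedding (\<lambda>x. block_pos ?B x (if x = a1 then a2 else 0)) t1 (inflation t1 ?B)"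
    by (rule embedding_transversal[where B = ?B, OF perm(1) B embedding_id])
      (use B0 Ba a in auto)
  moreover have "embedding (\<lambda>x. block_pos ?B a1 x) t2 (inflation t1 ?B)"
    by (rule embedding_into_block[where B = ?B, OF perm(1) B a1]) (simp only: Ba embedding_id)
  moreover have "inflation t1 ?B \<in> D"
  proof (rule lr_inflation_mem[OF D(2) t(1)])
    have "embedding id [1] t1" using perm by (simp add: embedding_singleton_iff is_perm_def)
    then have "[1] \<in> D"
      using D(1) t(1) is_perm_singleton unfolding perm_class_def contains_def by blast
    then show "((\<lambda>_. [1])(a1 := t2)) i \<in> D" for i using t(2) by simp
  qed
  moreover have "block_pos ?B a1 (if a1 = a1 then a2 else 0) = block_pos ?B a1 a2" by simp
  ultimately show ?thesis by blast
qed

lemma one_amalgamable_if_lr_amalgamable: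
  assumes D: "perm_class D" "closed_under_lr_inflations D" and am: "lr_amalgamable D"
  shows "one_amalgamable D"
  unfolding one_amalgamable_def embedding_singleton_iff comp_apply
proof (intro ballI allI impI, elim conjE)
  fix t1 t2 and f1 f2 :: "nat \<Rightarrow> nat"
  assume t: "t1 \<in> D" "t2 \<in> D" and f: "f1 0 < length t1" "f2 0 < length t2"
  consider "lr_min t1 (f1 0)" | "lr_min t2 (f2 0)" | "\<not> lr_min t1 (f1 0)" "\<not> lr_min t2 (f2 0)"
    by blast
  then show "\<exists>s\<in>D. \<exists>g1 g2. embedding g1 t1 s \<and> embedding g2 t2 s \<and> g1 (f1 0) = g2 (f2 0)"
  proof cases
    case 1
    then show ?thesis using ex_amalgam_at_lr_min[OF D t] f by blast
  next
    case 2
    then show ?thesis using ex_amalgam_at_lr_min[OF D t(2,1)] f by metis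
  next
    case 3
    have "amalgamable_in D t1 t2" using am t by (simp add: lr_amalgamable_iff)
    then obtain s g1 g2 where "s \<in> D" "lr_embedding g1 t1 s" "lr_embedding g2 t2 s"
        "g1 (f1 0) = g2 (f2 0)"
      using f 3 by (rule amalgamable_inD)
    then show ?thesis unfolding lr_embedding_def by blast
  qed
qed

theorem proposition4p10:
  fixes C :: "nat list set"
  assumes "perm_class C" and "lr_amalgamable C"
  shows "lr_amalgamable (lr_closure C) \<and> one_amalgamable (lr_closure C)"
proof -
  have "lr_amalgamable (lr_closure C)"
    using lr_amalgamable_lr_generated[OF assms] lr_closure_eq_lr_generated[OF assms(1)] by simp
  then show ?thesis
    using one_amalgamable_if_lr_amalgamable lr_closure_least(1,3)[OF assms(1)] by blast
qed

end
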